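(* There exist universal constants $c_\lambda,c_{\lambda_0},C>0$ such that the following holds. In the setting described in the context with $N=0$ (all predictors categorical), let $p_{\max}=\max_{j\in[q]}p_j$ and let $\lambda,\lambda_0\ge0$ satisfy at least one of $\lambda\ge c_\lambda\sigma^2p_{\max}\log(eq)/n$ and $\lambda_0\ge c_{\lambda_0}\sigma^2\log(ep)/n$. Let $(\hat\alpha,\hat{\boldsymbol\beta})$ be a global minimiser of $$\frac1n\|\boldsymbol y-\alpha\mathbf 1-\boldsymbol X\boldsymbol\beta\|_2^2+\lambda_0\|\boldsymbol\beta\|_0+\lambda\sum_{j=1}^q\big|\{\beta_k:k\in\mathcal I_j\}\big|$$ over $\alpha\in\mathbb R,\boldsymbol\beta\in\mathbb R^p$. Then, with probability at least $1-8(ep)^{-9}-8(eq)^{-9p_{\max}}$, $$\frac1n\|\mathbf f^*-\boldsymbol X\hat{\boldsymbol\beta}-\hat\alpha\mathbf 1\|_2^2\le C\inf_{\boldsymbol\beta\in\mathbb R^p,\alpha\in\mathbb R}\Big\{\frac1n\|\mathbf f^*-\boldsymbol X\boldsymbol\beta-\alpha\mathbf 1\|_2^2+\lambda_0(\|\boldsymbol\beta\|_0\vee1)+\lambda(K(\boldsymbol\beta)\vee1)\Big\}.$$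
   Context: Setting: $q\ge1$ categorical predictors, the $j$-th taking values in $[p_j]$, and no continuous predictors, so $p=\sum_{j=1}^qp_j$. There are $n$ observations; observation $i$ has values $C^{(i)}_j\in[p_j]$. The design matrix $\boldsymbol X\in\mathbb R^{n\times p}$ has $i$-th row $(\mathbf 1(C^{(i)}_1=1),\dots,\mathbf 1(C^{(i)}_1=p_1),\dots,\mathbf 1(C^{(i)}_q=1),\dots,\mathbf 1(C^{(i)}_q=p_q))$ with $\mathbf 1(\cdot)$ the indicator; $\mathcal I_1=\{1,\dots,p_1\}$, $\mathcal I_2=\{p_1+1,\dots,p_1+p_2\}$, etc. The data are $\boldsymbol y=\mathbf f^*+\boldsymbol\epsilon$ with $\mathbf f^*\in\mathbb R^n$ and $\boldsymbol X$ deterministic and $\boldsymbol\epsilon\sim\mathcal N(\mathbf 0,\sigma^2\boldsymbol I_n)$. $\mathbf 1$ is also the all-ones vector in $\mathbb R^n$. $K(\boldsymbol\beta)=\sum_{j=1}^q|\{\beta_i:i\in\mathcal I_j,\beta_i\ne0\}|$. $a\vee b=\max(a,b)$. Universal constants do not depend on $n,p,q,\sigma,\mathbf f^*,\boldsymbol X,\lambda,\lambda_0$. *)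

theory Defs
  imports "HOL-Probability.Probability"
begin

text \<open>Categorical design. Observation i (i < n) has category cat i j < p j for predictor j < q
  (categories are 0-indexed). A coefficient vector beta in R^p is represented as
  beta j k, the coefficient of level k of predictor j (only j < q, k < p j matter).
  Then (X beta)_i = sum_j beta j (cat i j).\<close>

definition fitted :: "nat \<Rightarrow> (nat \<Rightarrow> nat \<Rightarrow> nat) \<Rightarrow> real \<Rightarrow> (nat \<Rightarrow> nat \<Rightarrow> real) \<Rightarrow> nat \<Rightarrow> real" where
  "fitted q cat \<alpha> \<beta> i = \<alpha> + (\<Sum>j<q. \<beta> j (cat i j))"

definition l0norm :: "nat \<Rightarrow> (nat \<Rightarrow> nat) \<Rightarrow> (nat \<Rightarrow> nat \<Rightarrow> real) \<Rightarrow> nat" where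
  "l0norm q p \<beta> = card {(j, k). j < q \<and> k < p j \<and> \<beta> j k \<noteq> 0}"

definition ndistinct :: "nat \<Rightarrow> (nat \<Rightarrow> nat) \<Rightarrow> (nat \<Rightarrow> nat \<Rightarrow> real) \<Rightarrow> nat" where
  "ndistinct q p \<beta> = (\<Sum>j<q. card ((\<beta> j) ` {..<p j}))"

definition Kfun :: "nat \<Rightarrow> (nat \<Rightarrow> nat) \<Rightarrow> (nat \<Rightarrow> nat \<Rightarrow> real) \<Rightarrow> nat" where
  "Kfun q p \<beta> = (\<Sum>j<q. card ((\<beta> j) ` {..<p j} - {0}))"

definition objective :: "nat \<Rightarrow> nat \<Rightarrow> (nat \<Rightarrow> nat) \<Rightarrow> (nat \<Rightarrow> nat \<Rightarrow> nat) \<Rightarrow> (nat \<Rightarrow> real)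
    \<Rightarrow> real \<Rightarrow> real \<Rightarrow> real \<Rightarrow> (nat \<Rightarrow> nat \<Rightarrow> real) \<Rightarrow> real" where
  "objective n q p cat y lam0 lam \<alpha> \<beta> =
     (1 / real n) * (\<Sum>i<n. (y i - fitted q cat \<alpha> \<beta> i)\<^sup>2)
     + lam0 * real (l0norm q p \<beta>) + lam * real (ndistinct q p \<beta>)"

definition risk :: "nat \<Rightarrow> nat \<Rightarrow> (nat \<Rightarrow> nat \<Rightarrow> nat) \<Rightarrow> (nat \<Rightarrow> real) \<Rightarrow> real \<Rightarrow> (nat \<Rightarrow> nat \<Rightarrow> real) \<Rightarrow> real" where
  "risk n q cat f \<alpha> \<beta> = (1 / real n) * (\<Sum>i<n. (f i - fitted q cat \<alpha> \<beta> i)\<^sup>2)"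

definition noise_space :: "nat \<Rightarrow> real \<Rightarrow> (nat \<Rightarrow> real) measure" where
  "noise_space n \<sigma> = (\<Pi>\<^sub>M i\<in>{..<n}. density lborel (normal_density 0 \<sigma>))"

end

theory Submission
  imports Defs
begin

text \<open>Comparing the objective at the minimiser and at a competitor bounds the excess risk by penalty
  differences plus the noise paired with the difference \<open>v\<close> of the two fits. Let \<open>S\<close> be the set
  of predictors on which either coefficient vector is nonconstant (if \<open>lam\<close> is large), or the union
  of the two supports (if \<open>lam0\<close> is large). Then \<open>v\<close> lies in the span of the intercept and the
  columns belonging to \<open>S\<close>, and \<open>card S\<close> is at most the sum of the two penalty counts, where
  the number of distinct values is counted in excess of \<open>q\<close>, the value common to all vectors
  that are constant in each predictor. A union bound over all \<open>S\<close> of a chi-square tail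
  controls the projection of the noise on every such span simultaneously, so one event
  serves all competitors. The noise term costs a multiple of \<open>card S + 1\<close>, and with the
  constants below its part due to the minimiser is exactly cancelled by the minimiser's own penalty.\<close>

section \<open>Orthogonalisation\<close>

text \<open>Vectors of R^n are represented by functions on the naturals, and only the coordinates
  below \<open>n\<close> count. Equality of vectors is therefore always equality below
  \<open>n\<close>.\<close>

definition dotp :: "nat \<Rightarrow> (nat \<Rightarrow> real) \<Rightarrow> (nat \<Rightarrow> real) \<Rightarrow> real" where
  "dotp n x y = (\<Sum>i<n. x i * y i)"

lemma dotp_commute: "dotp n x y = dotp n y x"
  by (simp add: dotp_def mult.commute)

lemma dotp_sum_right: "dotp n x (\<lambda>i. \<Sum>a\<in>I. c a * u a i) = (\<Sum>a\<in>I. c a * dotp n x (u a))"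
proof -
  have "dotp n x (\<lambda>i. \<Sum>a\<in>I. c a * u a i) = (\<Sum>i<n. \<Sum>a\<in>I. c a * (x i * u a i))"
    unfolding dotp_def by (simp add: sum_distrib_left mult_ac)
  also have "\<dots> = (\<Sum>a\<in>I. \<Sum>i<n. c a * (x i * u a i))" by (rule sum.swap)
  finally show ?thesis by (simp add: dotp_def sum_distrib_left)
qed

lemma dotp_cong: "(\<And>i. i < n \<Longrightarrow> x i = x' i) \<Longrightarrow> (\<And>i. i < n \<Longrightarrow> y i = y' i) \<Longrightarrow> dotp n x y = dotp n x' y'"
  by (simp add: dotp_def)

lemma dotp_add_right: "dotp n x (\<lambda>i. y i + c * z i) = dotp n x y + c * dotp n x z"
  by (simp add: dotp_def algebra_simps sum.distrib sum_distrib_left)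

lemma dotp_add_left: "dotp n (\<lambda>i. y i + c * z i) x = dotp n y x + c * dotp n z x"
  using dotp_add_right dotp_commute by metis

lemma dotp_sum_left: "dotp n (\<lambda>i. \<Sum>a\<in>I. c a * u a i) x = (\<Sum>a\<in>I. c a * dotp n (u a) x)"
  unfolding dotp_commute[of n _ x] by (rule dotp_sum_right)

lemma dotp_self_eq_0: "dotp n x x = 0 \<Longrightarrow> i < n \<Longrightarrow> x i = 0"
  by (auto simp: dotp_def sum_nonneg_eq_0_iff)

text \<open>A vanishing residual is normalised to the zero vector (\<open>x / 0 = 0\<close>), so squared norms
  are 0 or 1 and no vectors have to be discarded.\<close>
lemma gram_schmidt:
  fixes w :: "'a \<Rightarrow> nat \<Rightarrow> real"
  assumes "finite I"
  shows "\<exists>u. (\<forall>a\<in>I. dotp n (u a) (u a) \<in> {0, 1}) \<and>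
             (\<forall>a\<in>I. \<forall>b\<in>I. a \<noteq> b \<longrightarrow> dotp n (u a) (u b) = 0) \<and>
             (\<forall>a\<in>I. \<forall>i<n. w a i = (\<Sum>b\<in>I. dotp n (w a) (u b) * u b i))"
  using assms
proof (induction I rule: finite_induct)
  case empty
  then show ?case by simp
next
  case (insert x I)
  from insert.IH obtain u where u: "\<forall>a\<in>I. dotp n (u a) (u a) \<in> {0, 1}"
      "\<forall>a\<in>I. \<forall>b\<in>I. a \<noteq> b \<longrightarrow> dotp n (u a) (u b) = 0"
      "\<forall>a\<in>I. \<forall>i<n. w a i = (\<Sum>b\<in>I. dotp n (w a) (u b) * u b i)"
    by (elim exE conjE) (rule that)
  note u1 = u(1)[rule_format] and u2 = u(2)[rule_format] and u3 = u(3)[rule_format]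
  define s where "s = (\<lambda>i. \<Sum>b\<in>I. dotp n (w x) (u b) * u b i)"
  define r where "r = (\<lambda>i. w x i + (-1) * s i)"
  define m where "m = sqrt (dotp n r r)"
  define z where "z = (\<lambda>i. (1 / m) * r i)"
  have m2: "m * m = dotp n r r"
    unfolding m_def by (simp add: dotp_def sum_nonneg)
  \<comment> \<open>If the squared norm is 1 there is nothing to do; if it is 0, then
    \<open>u a\<close> vanishes below \<open>n\<close> and both sides are 0. This lets zero vectors
    pass for unit vectors in the computation of the residual.\<close>
  have proj: "dotp n v (u a) * dotp n (u a) (u a) = dotp n v (u a)" if "a \<in> I" for v a
    using u1[OF that] dotp_self_eq_0[of n "u a"] by (auto simp: dotp_def[of n v])
  have scale: "dotp n v z = dotp n v r / m" for v
    by (simp add: z_def dotp_def sum_divide_distrib)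
  have r_orth: "dotp n (u a) r = 0" if a: "a \<in> I" for a
  proof -
    have "dotp n (u a) s = (\<Sum>b\<in>I. dotp n (w x) (u b) * dotp n (u a) (u b))"
      unfolding s_def by (rule dotp_sum_right)
    also have "\<dots> = (\<Sum>b\<in>I. if b = a then dotp n (w x) (u a) else 0)"
      using u2[OF a] proj[OF a] by (intro sum.cong) auto
    also have "\<dots> = dotp n (w x) (u a)" using a insert.hyps by simp
    finally show ?thesis
      unfolding r_def dotp_add_right by (simp add: dotp_commute)
  qed
  have z_orth: "dotp n (u a) z = 0" if "a \<in> I" for a
    using r_orth[OF that] by (simp add: scale)
  have zz: "dotp n z z \<in> {0, 1}"
  proof -
    \<comment> \<open>With \<open>m = 0\<close> the quotient is 0 by convention, otherwise it is
      1.\<close>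
    have "dotp n z z = (m * m) / (m * m)"
      unfolding scale m2 by (simp add: dotp_commute[of n z] scale flip: m2)
    then show ?thesis by simp
  qed
  have rs: "dotp n s r = 0"
    unfolding s_def dotp_sum_left by (intro sum.neutral) (auto simp: r_orth)
  \<comment> \<open>Since \<open>w x = r + s\<close> with \<open>s\<close> orthogonal to
    \<open>r\<close>, the coefficient of \<open>w x\<close> along \<open>z\<close> is the length of
    the residual.\<close>
  have wz: "dotp n (w x) z = m"
  proof -
    have "w x = (\<lambda>i. r i + 1 * s i)" by (simp add: r_def)
    then have "dotp n (w x) r = dotp n (\<lambda>i. r i + 1 * s i) r" by simp
    also have "\<dots> = m * m" unfolding dotp_add_left using rs m2 by simp
    finally show ?thesis by (simp add: scale)
  qed
  \<comment> \<open>In the degenerate case \<open>m = 0\<close> the residual itself is zero below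
    \<open>n\<close>, so the identity survives the division by 0.\<close>
  have rz: "r i = m * z i" if "i < n" for i
    using dotp_self_eq_0[of n r i] that by (cases "m = 0") (auto simp: z_def simp flip: m2)
  define u' where "u' = u(x := z)"
  have [simp]: "u' x = z" "\<And>a. a \<in> I \<Longrightarrow> u' a = u a"
    using insert.hyps by (auto simp: u'_def)
  have g1: "\<forall>a\<in>insert x I. dotp n (u' a) (u' a) \<in> {0, 1}"
    using u1 zz by auto
  have g2: "\<forall>a\<in>insert x I. \<forall>b\<in>insert x I. a \<noteq> b \<longrightarrow> dotp n (u' a) (u' b) = 0"
    using u2 z_orth z_orth[unfolded dotp_commute[of n _ z]] by auto
  have g3: "w a i = (\<Sum>b\<in>insert x I. dotp n (w a) (u' b) * u' b i)"
    if a: "a \<in> insert x I" and i: "i < n" for a i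
  proof (cases "a = x")
    case True
    have "w x i = m * z i + s i"
      using rz[OF i] by (simp add: r_def)
    then show ?thesis
      using insert.hyps True wz by (simp add: s_def)
  next
    case False
    then have aI: "a \<in> I" using a by simp
    have "dotp n (w a) z = dotp n (\<lambda>i. \<Sum>b\<in>I. dotp n (w a) (u b) * u b i) z"
      using u3[OF aI] by (intro dotp_cong) auto
    also have "\<dots> = 0"
      unfolding dotp_sum_left by (intro sum.neutral) (auto simp: z_orth)
    finally show ?thesis
      using insert.hyps u3[OF aI i] by simp
  qed
  show ?case
    by (intro exI[of _ u'] conjI g1 g2 ballI allI impI g3)
qed

section \<open>Gaussian noise\<close>

text \<open>Completing the square turns the exponentially tilted density into a constant times the
  normal density with mean \<open>\<sigma>\<^sup>2 * w\<close>, whose total mass is 1.\<close>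

lemma nn_integral_normal_exp:
  assumes "\<sigma> > 0"
  shows "(\<integral>\<^sup>+x. ennreal (exp (w * x)) \<partial>density lborel (normal_density 0 \<sigma>)) = ennreal (exp (\<sigma>\<^sup>2 * w\<^sup>2 / 2))"
proof -
  have eq: "normal_density 0 \<sigma> x * exp (w * x) = exp (\<sigma>\<^sup>2 * w\<^sup>2 / 2) * normal_density (\<sigma>\<^sup>2 * w) \<sigma> x" for x
  proof -
    have "- x\<^sup>2 / (2 * \<sigma>\<^sup>2) + w * x = \<sigma>\<^sup>2 * w\<^sup>2 / 2 + - (x - \<sigma>\<^sup>2 * w)\<^sup>2 / (2 * \<sigma>\<^sup>2)"
      using assms by (simp add: field_simps power2_eq_square)
    then have "exp (- x\<^sup>2 / (2 * \<sigma>\<^sup>2)) * exp (w * x) = exp (\<sigma>\<^sup>2 * w\<^sup>2 / 2) * exp (- (x - \<sigma>\<^sup>2 * w)\<^sup>2 / (2 * \<sigma>\<^sup>2))"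
      by (simp flip: exp_add)
    then show ?thesis by (simp add: normal_density_def)
  qed
  interpret N: prob_space "density lborel (normal_density (\<sigma>\<^sup>2 * w) \<sigma>)"
    using assms by (rule prob_space_normal_density)
  have one: "(\<integral>\<^sup>+x. ennreal (normal_density (\<sigma>\<^sup>2 * w) \<sigma> x) \<partial>lborel) = 1"
    using N.emeasure_space_1 by (simp add: emeasure_density)
  have "(\<integral>\<^sup>+x. ennreal (exp (w * x)) \<partial>density lborel (normal_density 0 \<sigma>))
      = (\<integral>\<^sup>+x. ennreal (normal_density 0 \<sigma> x * exp (w * x)) \<partial>lborel)"
    by (subst nn_integral_density) (auto simp: ennreal_mult)
  also have "\<dots> = (\<integral>\<^sup>+x. ennreal (exp (\<sigma>\<^sup>2 * w\<^sup>2 / 2)) * ennreal (normal_density (\<sigma>\<^sup>2 * w) \<sigma> x) \<partial>lborel)"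
    unfolding eq by (simp add: ennreal_mult)
  also have "\<dots> = ennreal (exp (\<sigma>\<^sup>2 * w\<^sup>2 / 2))"
    by (simp add: nn_integral_cmult one)
  finally show ?thesis .
qed

text \<open>Since -1/2 + 3/8 = -1/8, the weighted density is that of standard deviation 2 up to
  normalisation, and the ratio of the normalising constants is 2. The exponent 3/8 is chosen to make
  this value so simple.\<close>

lemma nn_integral_normal_exp_square:
  "(\<integral>\<^sup>+g. ennreal (exp (3 / 8 * g\<^sup>2)) \<partial>density lborel (normal_density 0 1)) = 2"
proof -
  interpret N: prob_space "density lborel (normal_density 0 2)"
    by (rule prob_space_normal_density) simp
  have one: "(\<integral>\<^sup>+x. ennreal (normal_density 0 2 x) \<partial>lborel) = 1"
    using N.emeasure_space_1 by (simp add: emeasure_density)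
  have eq: "normal_density 0 1 g * exp (3 / 8 * g\<^sup>2) = 2 * normal_density 0 2 g" for g
  proof -
    have "exp (- g\<^sup>2 / 2) * exp (3 / 8 * g\<^sup>2) = exp (- g\<^sup>2 / 8)"
      by (simp flip: exp_add add: field_simps)
    moreover have "sqrt (8 * pi) = 2 * sqrt (2 * pi)"
      using real_sqrt_mult[of 4 "2 * pi"] by simp
    ultimately show ?thesis by (simp add: normal_density_def)
  qed
  have "(\<integral>\<^sup>+g. ennreal (exp (3 / 8 * g\<^sup>2)) \<partial>density lborel (normal_density 0 1))
      = (\<integral>\<^sup>+g. ennreal (normal_density 0 1 g * exp (3 / 8 * g\<^sup>2)) \<partial>lborel)"
    by (subst nn_integral_density) (auto simp: ennreal_mult)
  also have "\<dots> = (\<integral>\<^sup>+g. 2 * ennreal (normal_density 0 2 g) \<partial>lborel)"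
    unfolding eq by (simp add: ennreal_mult)
  also have "\<dots> = 2" by (simp add: nn_integral_cmult one)
  finally show ?thesis .
qed

lemma prob_space_noise_space: "\<sigma> > 0 \<Longrightarrow> prob_space (noise_space n \<sigma>)"
  unfolding noise_space_def by (intro prob_space_PiM prob_space_normal_density)

lemma measurable_dotp_noise [measurable]:
  "(\<lambda>\<epsilon>. dotp n \<epsilon> u) \<in> borel_measurable (noise_space n \<sigma>)"
proof -
  have [measurable]: "(\<lambda>\<epsilon>. \<epsilon> i) \<in> borel_measurable (noise_space n \<sigma>)" if "i \<in> {..<n}" for i
    unfolding noise_space_def using measurable_component_singleton[OF that, of "\<lambda>_. density lborel (normal_density 0 \<sigma>)"]
    by (simp add: measurable_def)
  show ?thesis unfolding dotp_def by measurable
qed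

text \<open>The exponential of the sum is a product over independent coordinates, so the integral
  factors into one-dimensional ones.\<close>

lemma nn_integral_noise_exp_dotp:
  assumes "\<sigma> > 0"
  shows "(\<integral>\<^sup>+\<epsilon>. ennreal (exp (dotp n \<epsilon> w)) \<partial>noise_space n \<sigma>) = ennreal (exp (\<sigma>\<^sup>2 * dotp n w w / 2))"
proof -
  interpret product_prob_space "\<lambda>_. density lborel (normal_density 0 \<sigma>)" "{..<n}"
    by (intro product_prob_spaceI prob_space_normal_density assms)
  have "(\<integral>\<^sup>+\<epsilon>. ennreal (exp (dotp n \<epsilon> w)) \<partial>noise_space n \<sigma>)
      = (\<integral>\<^sup>+\<epsilon>. (\<Prod>i<n. ennreal (exp (w i * \<epsilon> i))) \<partial>noise_space n \<sigma>)"
    by (simp add: dotp_def exp_sum prod_ennreal mult.commute)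
  also have "\<dots> = (\<Prod>i<n. ennreal (exp (\<sigma>\<^sup>2 * (w i)\<^sup>2 / 2)))"
    unfolding noise_space_def
    by (subst product_nn_integral_prod) (auto simp: nn_integral_normal_exp[OF assms])
  also have "\<dots> = ennreal (exp (\<sigma>\<^sup>2 * dotp n w w / 2))"
    by (simp add: prod_ennreal flip: exp_sum)
       (simp add: dotp_def sum_distrib_left power2_eq_square mult_ac flip: sum_divide_distrib)
  finally show ?thesis .
qed

text \<open>Each square is linearised by an auxiliary standard Gaussian,
  \<open>exp (t\<^sup>2 / 2) = E exp (g t)\<close>; integrating the noise first leaves a one-dimensional Gaussian
  integral in \<open>g\<close>. The linear term \<open>dotp n \<epsilon> w\<close> carries the induction.\<close>
lemma nn_integral_noise_exp_squares:
  fixes u :: "'a \<Rightarrow> nat \<Rightarrow> real"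
  assumes \<sigma>: "\<sigma> > 0" and "finite I"
    and "\<And>a. a \<in> I \<Longrightarrow> dotp n (u a) (u a) \<le> 1"
    and "\<And>a b. a \<in> I \<Longrightarrow> b \<in> I \<Longrightarrow> a \<noteq> b \<Longrightarrow> dotp n (u a) (u b) = 0"
    and "\<And>a. a \<in> I \<Longrightarrow> dotp n w (u a) = 0"
  shows "(\<integral>\<^sup>+\<epsilon>. ennreal (exp (dotp n \<epsilon> w + 3 / (8 * \<sigma>\<^sup>2) * (\<Sum>a\<in>I. (dotp n \<epsilon> (u a))\<^sup>2))) \<partial>noise_space n \<sigma>)
         \<le> 2 ^ card I * ennreal (exp (\<sigma>\<^sup>2 * dotp n w w / 2))"
  using assms(2-)
proof (induction I arbitrary: w rule: finite_induct)
  case empty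
  then show ?case using nn_integral_noise_exp_dotp[OF \<sigma>, of n w] by simp
next
  case (insert x I)
  define G where "G = density lborel (normal_density 0 1)"
  \<comment> \<open>Chosen so that linearising \<open>exp ((r * t)\<^sup>2 / 2)\<close> reproduces
    the weight \<open>3 / (8 * \<sigma>\<^sup>2)\<close> of the squares.\<close>
  define r where "r = sqrt 3 / (2 * \<sigma>)"
  define Q where "Q = (\<lambda>\<epsilon>. 3 / (8 * \<sigma>\<^sup>2) * (\<Sum>a\<in>I. (dotp n \<epsilon> (u a))\<^sup>2))"
  \<comment> \<open>The auxiliary Gaussian \<open>g\<close> merges the square along
    \<open>u x\<close> into the linear term, which becomes the new \<open>w\<close> of the induction
    hypothesis.\<close>
  define v where "v = (\<lambda>g i. w i + (r * g) * u x i)"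
  have [measurable]: "Q \<in> borel_measurable (noise_space n \<sigma>)"
    unfolding Q_def by measurable
  have [measurable_cong]: "sets G = sets borel" by (simp add: G_def)
  interpret G: prob_space G unfolding G_def by (rule prob_space_normal_density) simp
  interpret N: prob_space "noise_space n \<sigma>" using \<sigma> by (rule prob_space_noise_space)
  interpret pair_sigma_finite "noise_space n \<sigma>" G ..
  have r2: "r\<^sup>2 = 3 / (4 * \<sigma>\<^sup>2)" by (simp add: r_def power_divide power_mult_distrib)
  have lin: "dotp n \<epsilon> (v g) = dotp n \<epsilon> w + r * g * dotp n \<epsilon> (u x)" for \<epsilon> g
    unfolding v_def by (rule dotp_add_right)
  have "(\<integral>\<^sup>+\<epsilon>. ennreal (exp (dotp n \<epsilon> w + 3 / (8 * \<sigma>\<^sup>2) * (\<Sum>a\<in>insert x I. (dotp n \<epsilon> (u a))\<^sup>2))) \<partial>noise_space n \<sigma>)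
      = (\<integral>\<^sup>+\<epsilon>. \<integral>\<^sup>+g. ennreal (exp (dotp n \<epsilon> (v g) + Q \<epsilon>)) \<partial>G \<partial>noise_space n \<sigma>)"
  proof (intro nn_integral_cong)
    fix \<epsilon>
    have "(\<integral>\<^sup>+g. ennreal (exp (dotp n \<epsilon> (v g) + Q \<epsilon>)) \<partial>G)
        = (\<integral>\<^sup>+g. ennreal (exp (dotp n \<epsilon> w + Q \<epsilon>)) * ennreal (exp ((r * dotp n \<epsilon> (u x)) * g)) \<partial>G)"
      unfolding lin by (intro nn_integral_cong) (simp add: mult_ac flip: ennreal_mult exp_add)
    also have "\<dots> = ennreal (exp (dotp n \<epsilon> w + Q \<epsilon>)) * ennreal (exp ((r * dotp n \<epsilon> (u x))\<^sup>2 / 2))"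
      unfolding G_def using nn_integral_normal_exp[of 1]
      by (subst nn_integral_cmult) auto
    also have "\<dots> = ennreal (exp (dotp n \<epsilon> w + 3 / (8 * \<sigma>\<^sup>2) * (\<Sum>a\<in>insert x I. (dotp n \<epsilon> (u a))\<^sup>2)))"
      using insert.hyps
      by (simp flip: ennreal_mult exp_add add: power_mult_distrib r2 Q_def algebra_simps)
    finally show "ennreal (exp (dotp n \<epsilon> w + 3 / (8 * \<sigma>\<^sup>2) * (\<Sum>a\<in>insert x I. (dotp n \<epsilon> (u a))\<^sup>2)))
        = (\<integral>\<^sup>+g. ennreal (exp (dotp n \<epsilon> (v g) + Q \<epsilon>)) \<partial>G)" by simp
  qed
  also have "\<dots> = (\<integral>\<^sup>+g. \<integral>\<^sup>+\<epsilon>. ennreal (exp (dotp n \<epsilon> (v g) + Q \<epsilon>)) \<partial>noise_space n \<sigma> \<partial>G)"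
    by (rule Fubini'[symmetric]) (simp add: lin)
  also have "\<dots> \<le> (\<integral>\<^sup>+g. (2 ^ card I * ennreal (exp (\<sigma>\<^sup>2 * dotp n w w / 2))) * ennreal (exp (3 / 8 * g\<^sup>2)) \<partial>G)"
  proof (intro nn_integral_mono)
    fix g
    \<comment> \<open>Both \<open>w\<close> and \<open>u x\<close> are orthogonal to the remaining
      vectors, so the hypothesis on the linear term is inherited.\<close>
    have vorth: "dotp n (v g) (u a) = 0" if "a \<in> I" for a
      using insert.prems(2)[of x a] insert.prems(3)[of a] insert.hyps that
      unfolding v_def dotp_add_left by auto
    have "dotp n (v g) (v g) = dotp n w w + (r * g)\<^sup>2 * dotp n (u x) (u x)"
      using insert.prems(3)[of x]
      unfolding v_def dotp_add_left dotp_add_right dotp_commute[of n "u x" w]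
      by (simp add: power2_eq_square)
    also have "\<dots> \<le> dotp n w w + (r * g)\<^sup>2"
      using insert.prems(1)[of x] mult_left_mono[of "dotp n (u x) (u x)" 1 "(r * g)\<^sup>2"] by simp
    \<comment> \<open>The variance of the noise cancels against that in \<open>r\<close>: half of
      \<open>\<sigma>\<^sup>2 * r\<^sup>2\<close> is 3/8, the exponent of the one-dimensional
      integral. That integral then contributes a factor 2 per vector.\<close>
    finally have "\<sigma>\<^sup>2 * dotp n (v g) (v g) / 2 \<le> \<sigma>\<^sup>2 * (dotp n w w + (r * g)\<^sup>2) / 2"
      by (simp add: mult_left_mono)
    also have "\<dots> = \<sigma>\<^sup>2 * dotp n w w / 2 + 3 / 8 * g\<^sup>2"
      using \<sigma> by (simp add: power_mult_distrib r2 field_simps)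
    finally have le: "ennreal (exp (\<sigma>\<^sup>2 * dotp n (v g) (v g) / 2))
        \<le> ennreal (exp (\<sigma>\<^sup>2 * dotp n w w / 2)) * ennreal (exp (3 / 8 * g\<^sup>2))"
      by (simp flip: ennreal_mult exp_add)
    have "(\<integral>\<^sup>+\<epsilon>. ennreal (exp (dotp n \<epsilon> (v g) + Q \<epsilon>)) \<partial>noise_space n \<sigma>)
        \<le> 2 ^ card I * ennreal (exp (\<sigma>\<^sup>2 * dotp n (v g) (v g) / 2))"
      unfolding Q_def using insert.prems vorth by (intro insert.IH) auto
    also have "\<dots> \<le> 2 ^ card I * (ennreal (exp (\<sigma>\<^sup>2 * dotp n w w / 2)) * ennreal (exp (3 / 8 * g\<^sup>2)))"
      by (intro mult_left_mono le) simp
    finally show "(\<integral>\<^sup>+\<epsilon>. ennreal (exp (dotp n \<epsilon> (v g) + Q \<epsilon>)) \<partial>noise_space n \<sigma>)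
      \<le> (2 ^ card I * ennreal (exp (\<sigma>\<^sup>2 * dotp n w w / 2))) * ennreal (exp (3 / 8 * g\<^sup>2))"
      by (simp add: mult.assoc)
  qed
  also have "\<dots> = (2 ^ card I * ennreal (exp (\<sigma>\<^sup>2 * dotp n w w / 2))) * 2"
    unfolding nn_integral_normal_exp_square[folded G_def, symmetric]
    by (rule nn_integral_cmult) measurable
  also have "\<dots> = 2 ^ card (insert x I) * ennreal (exp (\<sigma>\<^sup>2 * dotp n w w / 2))"
    using insert.hyps by (simp add: mult_ac)
  finally show ?case .
qed

text \<open>This is the Chernoff bound: Markov's inequality for the exponential moment of the sum of
  squares, taken with zero linear term.\<close>

lemma noise_squares_tail:
  fixes u :: "'a \<Rightarrow> nat \<Rightarrow> real"
  assumes \<sigma>: "\<sigma> > 0" and "finite I"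
    and "\<And>a. a \<in> I \<Longrightarrow> dotp n (u a) (u a) \<le> 1"
    and "\<And>a b. a \<in> I \<Longrightarrow> b \<in> I \<Longrightarrow> a \<noteq> b \<Longrightarrow> dotp n (u a) (u b) = 0"
  shows "measure (noise_space n \<sigma>) {\<epsilon> \<in> space (noise_space n \<sigma>). \<sigma>\<^sup>2 * t \<le> (\<Sum>a\<in>I. (dotp n \<epsilon> (u a))\<^sup>2)}
         \<le> 2 ^ card I * exp (- (3 / 8 * t))"
proof -
  interpret N: prob_space "noise_space n \<sigma>" using \<sigma> by (rule prob_space_noise_space)
  define Z where "Z = (\<lambda>\<epsilon>. \<Sum>a\<in>I. (dotp n \<epsilon> (u a))\<^sup>2)"
  have Zm [measurable]: "Z \<in> borel_measurable (noise_space n \<sigma>)"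
    unfolding Z_def by (intro borel_measurable_sum borel_measurable_power measurable_dotp_noise)
  define F where "F = (\<lambda>\<epsilon>. ennreal (exp (3 / (8 * \<sigma>\<^sup>2) * Z \<epsilon>)))"
  have Fm [measurable]: "F \<in> borel_measurable (noise_space n \<sigma>)" unfolding F_def using Zm by simp
  have "{\<epsilon> \<in> space (noise_space n \<sigma>). \<sigma>\<^sup>2 * t \<le> Z \<epsilon>}
      = {\<epsilon> \<in> space (noise_space n \<sigma>). 1 \<le> ennreal (exp (- (3 / 8 * t))) * F \<epsilon>}"
  proof -
    have "1 \<le> ennreal (exp (- (3 / 8 * t))) * F \<epsilon> \<longleftrightarrow> \<sigma>\<^sup>2 * t \<le> Z \<epsilon>" for \<epsilon>
    proof -
      have "1 \<le> ennreal (exp (- (3 / 8 * t))) * F \<epsilon> \<longleftrightarrow> 0 \<le> - (3 / 8 * t) + 3 / (8 * \<sigma>\<^sup>2) * Z \<epsilon>"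
        by (simp add: F_def flip: ennreal_mult exp_add)
      also have "\<dots> \<longleftrightarrow> \<sigma>\<^sup>2 * t \<le> Z \<epsilon>"
        using \<sigma> by (simp add: field_simps)
      finally show ?thesis .
    qed
    then show ?thesis by simp
  qed
  then have "emeasure (noise_space n \<sigma>) {\<epsilon> \<in> space (noise_space n \<sigma>). \<sigma>\<^sup>2 * t \<le> Z \<epsilon>}
      \<le> ennreal (exp (- (3 / 8 * t))) * (\<integral>\<^sup>+\<epsilon>. F \<epsilon> * indicator (space (noise_space n \<sigma>)) \<epsilon> \<partial>noise_space n \<sigma>)"
    by (simp only:) (rule nn_integral_Markov_inequality; measurable)
  also have "(\<integral>\<^sup>+\<epsilon>. F \<epsilon> * indicator (space (noise_space n \<sigma>)) \<epsilon> \<partial>noise_space n \<sigma>) = (\<integral>\<^sup>+\<epsilon>. F \<epsilon> \<partial>noise_space n \<sigma>)"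
    by (intro nn_integral_cong) simp
  also have "\<dots> \<le> 2 ^ card I"
    using nn_integral_noise_exp_squares[OF assms, where w = "\<lambda>_. 0"]
    by (simp add: F_def Z_def dotp_def)
  also have "ennreal (exp (- (3 / 8 * t))) * 2 ^ card I = ennreal (2 ^ card I * exp (- (3 / 8 * t)))"
    by (simp add: ennreal_mult ennreal_power[symmetric] mult.commute)
  finally show ?thesis
    unfolding Z_def by (simp add: N.emeasure_eq_measure mult_left_mono)
qed

section \<open>Uniform control of the noise over all selections\<close>

lemma sum_Pow_power_card:
  fixes x :: "'a::comm_semiring_1"
  assumes "finite J"
  shows "(\<Sum>S\<in>Pow J. x ^ card S) = (x + 1) ^ card J"
  using prod_add[OF assms, of "\<lambda>_. x" "\<lambda>_. 1"] by simp

text \<open>\<open>J\<close> is the set of selectable units and \<open>M\<close> bounds the number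
  of columns that one unit brings; the extra 1 is the intercept. The event is fixed before
  \<open>S\<close>, \<open>c\<close> and \<open>v\<close>, so these may depend on the noise, as the
  minimiser does. A selection \<open>S\<close> fails with probability at most
  \<open>exp (- 11 * L * (1 + card S))\<close>, which is small enough to be summed over all subsets
  of \<open>J\<close>.\<close>

lemma noise_event:
  fixes w :: "'b \<Rightarrow> nat \<Rightarrow> real" and I :: "'a set \<Rightarrow> 'b set"
  assumes \<sigma>: "\<sigma> > 0" and J: "finite J" "J \<noteq> {}" and M: "M \<ge> 1"
    and L: "real M * ln (exp 1 * real (card J)) \<le> L"
    and I: "\<forall>S\<in>Pow J. finite (I S) \<and> card (I S) \<le> 1 + card S * M"
  shows "\<exists>E\<in>sets (noise_space n \<sigma>). measure (noise_space n \<sigma>) E \<ge> 1 - exp (-9 * L) \<and>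
    (\<forall>\<epsilon>\<in>E. \<forall>S c v. S \<subseteq> J \<longrightarrow> (\<forall>i<n. v i = (\<Sum>a\<in>I S. c a * w a i)) \<longrightarrow>
       2 * dotp n \<epsilon> v \<le> dotp n v v / 4 + 128 * \<sigma>\<^sup>2 * L * (real (card S) + 1))"
proof -
  interpret N: prob_space "noise_space n \<sigma>" using \<sigma> by (rule prob_space_noise_space)
  have N1: "real (card J) \<ge> 1"
    using J by (simp add: Suc_le_eq card_gt_0_iff)
  have ln1: "ln (exp 1 * real (card J)) \<ge> 1"
    using N1 by (simp add: ln_mult)
  have MleL: "real M \<le> L"
    using L mult_left_mono[OF ln1, of "real M"] by simp
  have lnL: "ln (exp 1 * real (card J)) \<le> L"
  proof -
    have "1 * ln (exp 1 * real (card J)) \<le> real M * ln (exp 1 * real (card J))"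
      using M ln1 by (intro mult_right_mono) linarith+
    then show ?thesis using L by linarith
  qed
  have L1: "L \<ge> 1" using MleL M by simp
  have "\<forall>S\<in>Pow J. \<exists>u. (\<forall>a\<in>I S. dotp n (u a) (u a) \<in> {0, 1}) \<and>
             (\<forall>a\<in>I S. \<forall>b\<in>I S. a \<noteq> b \<longrightarrow> dotp n (u a) (u b) = 0) \<and>
             (\<forall>a\<in>I S. \<forall>i<n. w a i = (\<Sum>b\<in>I S. dotp n (w a) (u b) * u b i))"
    using gram_schmidt I by blast
  from bchoice[OF this] obtain U where U: "\<forall>S\<in>Pow J. (\<forall>a\<in>I S. dotp n (U S a) (U S a) \<in> {0, 1}) \<and>
             (\<forall>a\<in>I S. \<forall>b\<in>I S. a \<noteq> b \<longrightarrow> dotp n (U S a) (U S b) = 0) \<and>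
             (\<forall>a\<in>I S. \<forall>i<n. w a i = (\<Sum>b\<in>I S. dotp n (w a) (U S b) * U S b i))" ..
  have U1: "dotp n (U S a) (U S a) \<in> {0, 1}" if "S \<subseteq> J" "a \<in> I S" for S a
    using U that by simp
  have U2: "dotp n (U S a) (U S b) = 0" if "S \<subseteq> J" "a \<in> I S" "b \<in> I S" "a \<noteq> b" for S a b
    using U that by simp
  have U3: "w a i = (\<Sum>b\<in>I S. dotp n (w a) (U S b) * U S b i)" if "S \<subseteq> J" "a \<in> I S" "i < n" for S a i
    using bspec[OF U, of S] that by blast
  define Z where "Z = (\<lambda>S \<epsilon>. \<Sum>a\<in>I S. (dotp n \<epsilon> (U S a))\<^sup>2)"
  \<comment> \<open>The tail exponent is 3/8 of this, namely 12 times
    \<open>(card S + 1) * L\<close>. The dimension of the span uses up one of the 12 and leaves the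
    11 in \<open>x\<close>.\<close>
  define t where "t = (\<lambda>S::'a set. 32 * (real (card S) + 1) * L)"
  define B where "B = (\<lambda>S. {\<epsilon> \<in> space (noise_space n \<sigma>). \<sigma>\<^sup>2 * t S \<le> Z S \<epsilon>})"
  define x where "x = exp (-11 * L)"
  have [measurable]: "Z S \<in> borel_measurable (noise_space n \<sigma>)" for S
    unfolding Z_def by (intro borel_measurable_sum borel_measurable_power measurable_dotp_noise)
  have Bm [measurable]: "B S \<in> sets (noise_space n \<sigma>)" for S
    unfolding B_def by measurable
  have bound: "measure (noise_space n \<sigma>) (B S) \<le> x * x ^ card S" if S: "S \<subseteq> J" for S
  proof -
    have "dotp n (U S a) (U S a) \<le> 1" if "a \<in> I S" for a
      using U1[OF S that] by auto
    then have "measure (noise_space n \<sigma>) (B S) \<le> 2 ^ card (I S) * exp (- (3 / 8 * t S))"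
      unfolding B_def Z_def using U2[OF S] I S by (intro noise_squares_tail \<sigma>) auto
    also have "\<dots> \<le> exp (real (card (I S))) * exp (- (3 / 8 * t S))"
    proof -
      \<comment> \<open>Bounding the factor 2 per dimension by e turns the dimension into an
        exponent comparable with \<open>L\<close>.\<close>
      have "2 \<le> exp (1::real)" using exp_ge_add_one_self[of 1] by simp
      then have "2 ^ card (I S) \<le> exp (1::real) ^ card (I S)" by (intro power_mono) auto
      then show ?thesis by (simp flip: exp_of_nat_mult)
    qed
    also have "\<dots> \<le> exp (-11 * L * (1 + real (card S)))"
    proof -
      have "real (card (I S)) \<le> 1 + real (card S) * real M"
        using I S by (metis PowI of_nat_1 of_nat_add of_nat_le_iff of_nat_mult)
      also have "\<dots> \<le> L + real (card S) * L"
        using MleL L1 by (intro add_mono mult_left_mono) auto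
      finally show ?thesis by (simp add: t_def algebra_simps flip: exp_add)
    qed
    also have "\<dots> = x * x ^ card S"
      by (simp add: x_def algebra_simps flip: exp_add exp_of_nat_mult)
    finally show ?thesis .
  qed
  have "measure (noise_space n \<sigma>) (\<Union>S\<in>Pow J. B S) \<le> (\<Sum>S\<in>Pow J. measure (noise_space n \<sigma>) (B S))"
    using J by (intro N.finite_measure_subadditive_finite) auto
  also have "\<dots> \<le> (\<Sum>S\<in>Pow J. x * x ^ card S)"
    using bound by (intro sum_mono) auto
  \<comment> \<open>Grouping subsets by size is the binomial expansion; the outer factor
    \<open>x\<close> comes from the intercept's share and makes the total small.\<close>
  also have "\<dots> = x * (x + 1) ^ card J"
    using sum_Pow_power_card[OF J(1), of x] by (simp flip: sum_distrib_left)
  also have "\<dots> \<le> exp (-9 * L)"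
  proof -
    have "(x + 1) ^ card J \<le> exp x ^ card J"
      using exp_ge_add_one_self[of x] by (intro power_mono) (auto simp: x_def add.commute)
    also have "\<dots> = exp (real (card J) * x)" by (simp add: exp_of_nat_mult)
    also have "\<dots> \<le> exp 1"
    proof -
      \<comment> \<open>As \<open>L\<close> dominates \<open>ln (exp 1 * card J)\<close>, the
        reciprocal of \<open>card J\<close> bounds \<open>x\<close>, so the sum over subsets costs
        at most a factor e. From the exponent 11 to 9 there is room for it because
        \<open>L \<ge> 1\<close>.\<close>
      have "x \<le> exp (- ln (exp 1 * real (card J)))"
        using lnL L1 by (simp add: x_def)
      also have "\<dots> = 1 / (exp 1 * real (card J))"
        using N1 by (simp add: exp_minus inverse_eq_divide)
      also have "\<dots> \<le> 1 / real (card J)"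
        using N1 by (intro divide_left_mono) auto
      finally show ?thesis using N1 by (simp add: field_simps)
    qed
    finally have "x * (x + 1) ^ card J \<le> x * exp 1"
      by (intro mult_left_mono) (auto simp: x_def)
    also have "\<dots> \<le> exp (-9 * L)"
      using L1 by (simp add: x_def flip: exp_add)
    finally show ?thesis .
  qed
  finally have bad: "measure (noise_space n \<sigma>) (\<Union>S\<in>Pow J. B S) \<le> exp (-9 * L)" .
  define E where "E = space (noise_space n \<sigma>) - (\<Union>S\<in>Pow J. B S)"
  have Um: "(\<Union>S\<in>Pow J. B S) \<in> sets (noise_space n \<sigma>)"
    using J by (intro sets.finite_UN) auto
  have Em: "E \<in> sets (noise_space n \<sigma>)" unfolding E_def using Um by auto
  have "measure (noise_space n \<sigma>) E \<ge> 1 - exp (-9 * L)"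
    unfolding E_def using N.prob_compl[OF Um] bad by simp
  moreover have "2 * dotp n \<epsilon> v \<le> dotp n v v / 4 + 128 * \<sigma>\<^sup>2 * L * (real (card S) + 1)"
    if \<epsilon>: "\<epsilon> \<in> E" and S: "S \<subseteq> J" and v: "\<forall>i<n. v i = (\<Sum>a\<in>I S. c a * w a i)" for \<epsilon> S c v
  proof -
    \<comment> \<open>These are the coordinates of \<open>v\<close> in the orthonormalised system of
      the span belonging to \<open>S\<close>.\<close>
    define d where "d = (\<lambda>b. dotp n v (U S b))"
    have d_eq: "d b = (\<Sum>a\<in>I S. c a * dotp n (w a) (U S b))" for b
    proof -
      have "d b = dotp n (\<lambda>i. \<Sum>a\<in>I S. c a * w a i) (U S b)"
        unfolding d_def using v by (intro dotp_cong) auto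
      then show ?thesis by (simp add: dotp_sum_left)
    qed
    have v_eq: "v i = (\<Sum>b\<in>I S. d b * U S b i)" if i: "i < n" for i
    proof -
      have "v i = (\<Sum>a\<in>I S. c a * (\<Sum>b\<in>I S. dotp n (w a) (U S b) * U S b i))"
        using v i U3[OF S _ i] by simp
      also have "\<dots> = (\<Sum>a\<in>I S. \<Sum>b\<in>I S. c a * dotp n (w a) (U S b) * U S b i)"
        by (simp add: sum_distrib_left mult.assoc)
      also have "\<dots> = (\<Sum>b\<in>I S. \<Sum>a\<in>I S. c a * dotp n (w a) (U S b) * U S b i)"
        by (rule sum.swap)
      finally show ?thesis by (simp add: d_eq sum_distrib_right)
    qed
    have expand: "dotp n y v = (\<Sum>b\<in>I S. d b * dotp n y (U S b))" for y
    proof -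
      have "dotp n y v = dotp n y (\<lambda>i. \<Sum>b\<in>I S. d b * U S b i)"
        using v_eq by (intro dotp_cong) auto
      then show ?thesis by (simp add: dotp_sum_right)
    qed
    have "2 * dotp n \<epsilon> v = (\<Sum>b\<in>I S. 2 * (d b * dotp n \<epsilon> (U S b)))"
      by (simp add: expand sum_distrib_left)
    also have "\<dots> \<le> (\<Sum>b\<in>I S. (d b)\<^sup>2 / 4 + 4 * (dotp n \<epsilon> (U S b))\<^sup>2)"
    proof (intro sum_mono)
      fix b
      \<comment> \<open>Young's inequality with weights 1/4 and 4. The 1/4 is later absorbed into
        the risks, and 4 times the 32 in \<open>t\<close> gives the constant 128.\<close>
      show "2 * (d b * dotp n \<epsilon> (U S b)) \<le> (d b)\<^sup>2 / 4 + 4 * (dotp n \<epsilon> (U S b))\<^sup>2"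
        using zero_le_power2[of "d b / 2 - 2 * dotp n \<epsilon> (U S b)"]
        by (simp add: power2_eq_square algebra_simps)
    qed
    also have "\<dots> = dotp n v v / 4 + 4 * Z S \<epsilon>"
    proof -
      \<comment> \<open>Parseval's identity, obtained by expanding \<open>v\<close> against itself;
        zero vectors of the system contribute nothing.\<close>
      have "dotp n v v = (\<Sum>b\<in>I S. (d b)\<^sup>2)"
        unfolding expand[of v] by (simp add: d_def power2_eq_square)
      then show ?thesis
        by (simp add: Z_def sum.distrib sum_distrib_left sum_divide_distrib)
    qed
    also have "\<dots> \<le> dotp n v v / 4 + 4 * (\<sigma>\<^sup>2 * t S)"
    proof -
      have "\<epsilon> \<in> space (noise_space n \<sigma>)" "\<epsilon> \<notin> B S"
        using \<epsilon> S by (auto simp: E_def)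
      then have "Z S \<epsilon> < \<sigma>\<^sup>2 * t S" by (simp add: B_def)
      then show ?thesis by linarith
    qed
    finally show ?thesis by (simp add: t_def algebra_simps)
  qed
  ultimately show ?thesis using Em by (intro bexI[of _ E] conjI ballI allI impI)
qed

section \<open>The oracle inequality\<close>

text \<open>The square of the noise occurs in both objectives and cancels, which leaves the
  difference of the two squared errors and a cross term with \<open>v\<close>. The part of the noise
  bound quadratic in \<open>v\<close> is at most half of the sum of both squared errors, so it can
  be moved to the left.\<close>

lemma basic_inequality:
  fixes q :: nat and cat \<alpha>h \<beta>h \<alpha> \<beta>
  defines "v \<equiv> \<lambda>i. fitted q cat \<alpha>h \<beta>h i - fitted q cat \<alpha> \<beta> i"
  assumes n: "n \<ge> 1"
    and min: "objective n q p cat (\<lambda>i. f i + \<epsilon> i) lam0 lam \<alpha>h \<beta>h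
              \<le> objective n q p cat (\<lambda>i. f i + \<epsilon> i) lam0 lam \<alpha> \<beta>"
    and noise: "2 * dotp n \<epsilon> v \<le> dotp n v v / 4 + real n * G"
  shows "risk n q cat f \<alpha>h \<beta>h \<le> 3 * risk n q cat f \<alpha> \<beta> + 2 * G
    + 2 * lam0 * (real (l0norm q p \<beta>) - real (l0norm q p \<beta>h))
    + 2 * lam * (real (ndistinct q p \<beta>) - real (ndistinct q p \<beta>h))"
proof -
  define a where "a = (\<lambda>i. f i - fitted q cat \<alpha>h \<beta>h i)"
  define b where "b = (\<lambda>i. f i - fitted q cat \<alpha> \<beta> i)"
  define A where "A = (\<Sum>i<n. (a i)\<^sup>2)"
  define B where "B = (\<Sum>i<n. (b i)\<^sup>2)"
  define D where "D = lam0 * (real (l0norm q p \<beta>) - real (l0norm q p \<beta>h))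
      + lam * (real (ndistinct q p \<beta>) - real (ndistinct q p \<beta>h))"
  have d_ab: "v i = b i - a i" for i by (simp add: v_def a_def b_def)
  have cross: "(\<Sum>i<n. (f i + \<epsilon> i - fitted q cat \<alpha>h \<beta>h i)\<^sup>2) - (\<Sum>i<n. (f i + \<epsilon> i - fitted q cat \<alpha> \<beta> i)\<^sup>2)
      = A - B - 2 * dotp n \<epsilon> v"
    unfolding A_def B_def dotp_def sum_distrib_left sum_subtractf[symmetric] d_ab a_def b_def
    by (intro sum.cong) (auto simp: power2_eq_square algebra_simps)
  have "dotp n v v \<le> (\<Sum>i<n. 2 * (a i)\<^sup>2 + 2 * (b i)\<^sup>2)"
    unfolding dotp_def
  proof (intro sum_mono)
    fix i show "v i * v i \<le> 2 * (a i)\<^sup>2 + 2 * (b i)\<^sup>2"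
      using zero_le_power2[of "a i + b i"] by (simp add: d_ab power2_eq_square algebra_simps)
  qed
  then have dd: "dotp n v v \<le> 2 * A + 2 * B"
    by (simp add: A_def B_def sum.distrib sum_distrib_left)
  have "(1 / real n) * ((\<Sum>i<n. (f i + \<epsilon> i - fitted q cat \<alpha>h \<beta>h i)\<^sup>2) - (\<Sum>i<n. (f i + \<epsilon> i - fitted q cat \<alpha> \<beta> i)\<^sup>2)) \<le> D"
    using min unfolding objective_def D_def by (simp add: algebra_simps)
  then have "(A - B - 2 * dotp n \<epsilon> v) / real n \<le> D"
    unfolding cross by simp
  then have "A - B - 2 * dotp n \<epsilon> v \<le> real n * D"
    using n by (simp add: field_simps)
  \<comment> \<open>From \<open>A \<le> B + (A + B) / 2 + real n * (G + D)\<close>, solving for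
    \<open>A\<close> doubles the remainder and gives the factor 3 at \<open>B\<close>.\<close>
  then have "A \<le> 3 * B + real n * (2 * G + 2 * D)"
    using noise dd by (simp add: algebra_simps)
  then have "A / real n \<le> 3 * (B / real n) + 2 * G + 2 * D"
    using n by (simp add: field_simps)
  then show ?thesis
    unfolding risk_def D_def A_def B_def a_def b_def by (simp add: algebra_simps)
qed

section \<open>Counting distinct coefficient values\<close>

lemma ndistinct_le: "ndistinct q p \<beta> \<le> q + Kfun q p \<beta>"
proof -
  have "card (\<beta> j ` {..<p j}) \<le> 1 + card (\<beta> j ` {..<p j} - {0})" for j
  proof -
    \<comment> \<open>Adjoining the value 0 makes the count exactly one more than the number of
      nonzero values, whether or not 0 occurs.\<close>
    have "card (\<beta> j ` {..<p j}) \<le> card (insert 0 (\<beta> j ` {..<p j}))"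
      by (intro card_mono) auto
    also have "\<dots> = Suc (card (\<beta> j ` {..<p j} - {0}))"
      by (rule card.insert_remove) simp
    finally show ?thesis by linarith
  qed
  then have "ndistinct q p \<beta> \<le> (\<Sum>j<q. 1 + card (\<beta> j ` {..<p j} - {0}))"
    unfolding ndistinct_def by (intro sum_mono)
  then show ?thesis unfolding sum.distrib Kfun_def by simp
qed

text \<open>Level 0 serves as reference: for a predictor outside this set,
  \<open>\<beta> j 0\<close> is the value that can be moved into the intercept.\<close>

definition nonconstant :: "nat \<Rightarrow> (nat \<Rightarrow> nat) \<Rightarrow> (nat \<Rightarrow> nat \<Rightarrow> real) \<Rightarrow> nat set" where
  "nonconstant q p \<beta> = {j. j < q \<and> (\<exists>k<p j. \<beta> j k \<noteq> \<beta> j 0)}"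

text \<open>Each predictor has at least one value, and each nonconstant one has a second. The excess
  over \<open>q\<close> thus pays for the predictors that enter the span.\<close>

lemma ndistinct_ge:
  assumes "\<forall>j<q. p j \<ge> 1"
  shows "q + card (nonconstant q p \<beta>) \<le> ndistinct q p \<beta>"
proof -
  have "1 + of_bool (j \<in> nonconstant q p \<beta>) \<le> card (\<beta> j ` {..<p j})" if j: "j < q" for j
  proof (cases "j \<in> nonconstant q p \<beta>")
    case True
    then obtain k where "k < p j" "\<beta> j k \<noteq> \<beta> j 0" by (auto simp: nonconstant_def)
    then have "card {\<beta> j k, \<beta> j 0} \<le> card (\<beta> j ` {..<p j})"
      by (intro card_mono) auto
    then show ?thesis using True \<open>\<beta> j k \<noteq> \<beta> j 0\<close> by simp
  next
    case False
    have "card {\<beta> j 0} \<le> card (\<beta> j ` {..<p j})"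
      using assms j by (intro card_mono) (auto simp: Suc_le_eq)
    then show ?thesis using False by simp
  qed
  then have "(\<Sum>j<q. 1 + of_bool (j \<in> nonconstant q p \<beta>)) \<le> ndistinct q p \<beta>"
    unfolding ndistinct_def by (intro sum_mono) auto
  moreover have "(\<Sum>j<q. 1 + of_bool (j \<in> nonconstant q p \<beta>)) = q + card (nonconstant q p \<beta>)"
  proof -
    have "{..<q} \<inter> {j. j \<in> nonconstant q p \<beta>} = nonconstant q p \<beta>"
      by (auto simp: nonconstant_def)
    then show ?thesis unfolding sum.distrib by simp
  qed
  ultimately show ?thesis by simp
qed

section \<open>Differences of fits as combinations of columns\<close>

text \<open>Columns of the design matrix, with \<open>None\<close> for the intercept.\<close>
definition column :: "(nat \<Rightarrow> nat \<Rightarrow> nat) \<Rightarrow> (nat \<times> nat) option \<Rightarrow> nat \<Rightarrow> real" where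
  "column cat a i = (case a of None \<Rightarrow> 1 | Some (j, k) \<Rightarrow> of_bool (cat i j = k))"

lemma sum_column:
  assumes "finite A"
  shows "(\<Sum>a\<in>insert None (Some ` A). c a * column cat a i)
    = c None + (\<Sum>(j, k)\<in>A. c (Some (j, k)) * of_bool (cat i j = k))"
  using assms by (simp add: column_def sum.reindex split_def)

text \<open>An observation has exactly one level of each predictor, and it lies in range, so a
  single indicator survives in each inner sum.\<close>

lemma sum_levels:
  fixes cat :: "nat \<Rightarrow> nat \<Rightarrow> nat" and p :: "nat \<Rightarrow> nat"
  assumes "finite S" and "\<forall>j\<in>S. cat i j < p j"
  shows "(\<Sum>(j, k)\<in>Sigma S (\<lambda>j. {..<p j}). \<delta> j k * of_bool (cat i j = k)) = (\<Sum>j\<in>S. (\<delta> j (cat i j) :: real))"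
proof -
  have "(\<Sum>k<p j. \<delta> j k * of_bool (cat i j = k)) = \<delta> j (cat i j)" if "j \<in> S" for j
  proof -
    have "(\<Sum>k<p j. \<delta> j k * of_bool (cat i j = k)) = (\<Sum>k<p j. if k = cat i j then \<delta> j k else 0)"
      by (intro sum.cong) auto
    then show ?thesis using assms that by simp
  qed
  then show ?thesis
    using assms(1) by (simp flip: sum.Sigma)
qed

lemma fitted_diff: "fitted q cat \<alpha> \<beta> i - fitted q cat \<alpha>' \<beta>' i
    = (\<alpha> - \<alpha>') + (\<Sum>j<q. \<beta> j (cat i j) - \<beta>' j (cat i j))"
  by (simp add: fitted_def sum_subtractf)

text \<open>A predictor on which both coefficient vectors are constant shifts all observations by
  the same amount. It therefore needs no column of its own.\<close>

lemma fitted_diff_predictors: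
  fixes \<beta> \<beta>' :: "nat \<Rightarrow> nat \<Rightarrow> real"
  assumes cat: "\<forall>i<n. \<forall>j<q. cat i j < p j"
  defines "S \<equiv> nonconstant q p \<beta> \<union> nonconstant q p \<beta>'"
  shows "\<exists>c. \<forall>i<n. fitted q cat \<alpha> \<beta> i - fitted q cat \<alpha>' \<beta>' i
    = (\<Sum>a\<in>insert None (Some ` Sigma S (\<lambda>j. {..<p j})). c a * column cat a i)"
proof -
  have S: "S \<subseteq> {..<q}" by (auto simp: S_def nonconstant_def)
  then have fS: "finite S" by (rule finite_subset) simp
  define \<delta> where "\<delta> = (\<lambda>j k. \<beta> j k - \<beta>' j k)"
  \<comment> \<open>The coefficient of the intercept collects these shifts, evaluated at the
    reference level.\<close>
  define c where "c = case_option (\<alpha> - \<alpha>' + (\<Sum>j\<in>{..<q} - S. \<delta> j 0)) (\<lambda>(j, k). \<delta> j k)"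
  have "fitted q cat \<alpha> \<beta> i - fitted q cat \<alpha>' \<beta>' i
    = (\<Sum>a\<in>insert None (Some ` Sigma S (\<lambda>j. {..<p j})). c a * column cat a i)" if i: "i < n" for i
  proof -
    have catS: "\<forall>j\<in>S. cat i j < p j" using cat i S by auto
    have "\<delta> j (cat i j) = \<delta> j 0" if "j \<in> {..<q} - S" for j
      using that cat i by (auto simp: S_def nonconstant_def \<delta>_def)
    then have "(\<Sum>j<q. \<delta> j (cat i j)) = (\<Sum>j\<in>{..<q} - S. \<delta> j 0) + (\<Sum>j\<in>S. \<delta> j (cat i j))"
      using sum.subset_diff[OF S, of "\<lambda>j. \<delta> j (cat i j)"] by simp
    then show ?thesis
      using fS sum_levels[where \<delta> = \<delta> and cat = cat and p = p and i = i, OF fS catS] unfolding fitted_diff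
      by (subst sum_column) (auto simp: c_def \<delta>_def)
  qed
  then show ?thesis by blast
qed

text \<open>Outside the union of the supports both coefficients are 0, so their difference drops out
  and the intercept takes only the difference of the intercepts.\<close>

lemma fitted_diff_support:
  fixes \<beta> \<beta>' :: "nat \<Rightarrow> nat \<Rightarrow> real"
  assumes cat: "\<forall>i<n. \<forall>j<q. cat i j < p j"
  defines "S \<equiv> {(j, k). j < q \<and> k < p j \<and> \<beta> j k \<noteq> 0} \<union> {(j, k). j < q \<and> k < p j \<and> \<beta>' j k \<noteq> 0}"
  shows "\<exists>c. \<forall>i<n. fitted q cat \<alpha> \<beta> i - fitted q cat \<alpha>' \<beta>' i
    = (\<Sum>a\<in>insert None (Some ` S). c a * column cat a i)"
proof -
  let ?A = "Sigma {..<q} (\<lambda>j. {..<p j})"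
  have S: "S \<subseteq> ?A" by (auto simp: S_def)
  then have fS: "finite S" by (rule finite_subset) simp
  define \<delta> where "\<delta> = (\<lambda>j k. \<beta> j k - \<beta>' j k)"
  define c where "c = case_option (\<alpha> - \<alpha>') (\<lambda>(j, k). \<delta> j k)"
  have "fitted q cat \<alpha> \<beta> i - fitted q cat \<alpha>' \<beta>' i
    = (\<Sum>a\<in>insert None (Some ` S). c a * column cat a i)" if i: "i < n" for i
  proof -
    have "(\<Sum>(j, k)\<in>S. \<delta> j k * of_bool (cat i j = k)) = (\<Sum>(j, k)\<in>?A. \<delta> j k * of_bool (cat i j = k))"
      by (intro sum.mono_neutral_left S) (auto simp: S_def \<delta>_def)
    also have "\<dots> = (\<Sum>j<q. \<delta> j (cat i j))"
      using cat i by (intro sum_levels) auto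
    finally show ?thesis
      using fS unfolding fitted_diff by (subst sum_column) (auto simp: c_def \<delta>_def)
  qed
  then show ?thesis by blast
qed

section \<open>The events for a large clustering penalty and a large sparsity penalty\<close>

abbreviation (input) oracle_bound where
  "oracle_bound n q p cat f lam0 lam \<alpha> \<beta> \<equiv> risk n q cat f \<alpha> \<beta>
     + lam0 * max (real (l0norm q p \<beta>)) 1 + lam * max (real (Kfun q p \<beta>)) 1"

lemma oracle_event_clustering:
  assumes n: "n \<ge> 1" and q: "q \<ge> 1" and p: "\<forall>j<q. p j \<ge> 1"
    and cat: "\<forall>i<n. \<forall>j<q. cat i j < p j" and \<sigma>: "\<sigma> > 0" and lam0: "lam0 \<ge> 0"
  defines "L \<equiv> real (Max (p ` {..<q})) * ln (exp 1 * real q)"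
  assumes lam: "lam \<ge> 128 * \<sigma>\<^sup>2 * L / real n"
  shows "\<exists>E\<in>sets (noise_space n \<sigma>). measure (noise_space n \<sigma>) E \<ge> 1 - exp (-9 * L) \<and>
    (\<forall>\<epsilon>\<in>E. \<forall>\<alpha>h \<beta>h \<alpha> \<beta>.
       objective n q p cat (\<lambda>i. f i + \<epsilon> i) lam0 lam \<alpha>h \<beta>h
         \<le> objective n q p cat (\<lambda>i. f i + \<epsilon> i) lam0 lam \<alpha> \<beta> \<longrightarrow>
       risk n q cat f \<alpha>h \<beta>h \<le> 6 * oracle_bound n q p cat f lam0 lam \<alpha> \<beta>)"
proof -
  define M where "M = Max (p ` {..<q})"
  define I where "I = (\<lambda>S. insert None (Some ` Sigma S (\<lambda>j. {..<p j})))"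
  have pM: "p j \<le> M" if "j < q" for j using that by (auto simp: M_def)
  have J0: "{..<q} \<noteq> {}" using q by (simp add: lessThan_empty_iff)
  have M1: "M \<ge> 1" using pM[of 0] p q by fastforce
  have I: "\<forall>S\<in>Pow {..<q}. finite (I S) \<and> card (I S) \<le> 1 + card S * M"
  proof
    fix S assume S: "S \<in> Pow {..<q}"
    then have fS: "finite S" by (auto intro: finite_subset)
    have "card (Sigma S (\<lambda>j. {..<p j})) = (\<Sum>j\<in>S. p j)" using fS by simp
    also have "\<dots> \<le> (\<Sum>j\<in>S. M)" using S pM by (intro sum_mono) auto
    finally show "finite (I S) \<and> card (I S) \<le> 1 + card S * M"
      using fS by (simp add: I_def card_image)
  qed
  have Lpos: "L \<ge> 0" using q by (simp add: L_def ln_mult)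
  have lampos: "lam \<ge> 0"
  proof -
    have "0 \<le> 128 * \<sigma>\<^sup>2 * L / real n" using Lpos by simp
    then show ?thesis using lam by (rule order_trans)
  qed
  have "real M * ln (exp 1 * real (card {..<q})) \<le> L" by (simp add: L_def M_def)
  from noise_event[of \<sigma> "{..<q}" M L I n "column cat", OF \<sigma> finite_lessThan J0 M1 this I]
  obtain E where E: "E \<in> sets (noise_space n \<sigma>)" "measure (noise_space n \<sigma>) E \<ge> 1 - exp (-9 * L)"
    and noise: "\<forall>\<epsilon>\<in>E. \<forall>S c v. S \<subseteq> {..<q} \<longrightarrow> (\<forall>i<n. v i = (\<Sum>a\<in>I S. c a * column cat a i)) \<longrightarrow>
       2 * dotp n \<epsilon> v \<le> dotp n v v / 4 + 128 * \<sigma>\<^sup>2 * L * (real (card S) + 1)"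
    by (elim bexE conjE) (rule that)
  have "risk n q cat f \<alpha>h \<beta>h \<le> 6 * oracle_bound n q p cat f lam0 lam \<alpha> \<beta>"
    if \<epsilon>: "\<epsilon> \<in> E" and min: "objective n q p cat (\<lambda>i. f i + \<epsilon> i) lam0 lam \<alpha>h \<beta>h
         \<le> objective n q p cat (\<lambda>i. f i + \<epsilon> i) lam0 lam \<alpha> \<beta>" for \<epsilon> \<alpha>h \<beta>h \<alpha> \<beta>
  proof -
    let ?S = "nonconstant q p \<beta>h \<union> nonconstant q p \<beta>"
    let ?v = "\<lambda>i. fitted q cat \<alpha>h \<beta>h i - fitted q cat \<alpha> \<beta> i"
    let ?kh = "real (ndistinct q p \<beta>h) - real q" and ?k = "real (ndistinct q p \<beta>) - real q"
    obtain c where c: "\<forall>i<n. ?v i = (\<Sum>a\<in>I ?S. c a * column cat a i)"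
      unfolding I_def using fitted_diff_predictors[OF cat] by blast
    have S: "?S \<subseteq> {..<q}" by (auto simp: nonconstant_def)
    have "card ?S \<le> card (nonconstant q p \<beta>h) + card (nonconstant q p \<beta>)" by (rule card_Un_le)
    then have cardS: "real (card ?S) \<le> ?kh + ?k"
      using ndistinct_ge[OF p, of \<beta>h] ndistinct_ge[OF p, of \<beta>] by linarith
    \<comment> \<open>The selection depends on the noise through the minimiser, which the uniformity
      of the event in \<open>S\<close> and \<open>c\<close> permits.\<close>
    have "2 * dotp n \<epsilon> ?v \<le> dotp n ?v ?v / 4 + 128 * \<sigma>\<^sup>2 * L * (real (card ?S) + 1)"
      by (rule noise[THEN bspec, OF \<epsilon>, THEN spec, THEN spec, THEN spec, THEN mp, THEN mp, OF S c])
    also have "128 * \<sigma>\<^sup>2 * L * (real (card ?S) + 1) \<le> (real n * lam) * (?kh + ?k + 1)"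
    proof (rule mult_mono)
      show "128 * \<sigma>\<^sup>2 * L \<le> real n * lam" using lam n by (simp add: field_simps)
    qed (use lampos cardS in auto)
    finally have "2 * dotp n \<epsilon> ?v \<le> dotp n ?v ?v / 4 + real n * (lam * (?kh + ?k + 1))"
      by (simp add: mult.assoc)
    \<comment> \<open>Twice the noise bound contains \<open>2 * lam * ?kh\<close>, which the penalty
      difference removes exactly. For the competitor, 2 from the noise and 2 from the penalty add up
      to 4.\<close>
    from basic_inequality[OF n min this]
    have "risk n q cat f \<alpha>h \<beta>h \<le> 3 * risk n q cat f \<alpha> \<beta> + lam * (4 * ?k + 2)
        + 2 * (lam0 * real (l0norm q p \<beta>)) - 2 * (lam0 * real (l0norm q p \<beta>h))"
      by (simp add: algebra_simps)
    \<comment> \<open>The additive 2 is due to the intercept; it is why the maximum with 1 appears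
      and why the constant is 6.\<close>
    moreover have "lam * (4 * ?k + 2) \<le> lam * (6 * max (real (Kfun q p \<beta>)) 1)"
    proof (rule mult_left_mono[OF _ lampos])
      have "?k \<le> real (Kfun q p \<beta>)" using ndistinct_le[of q p \<beta>] by linarith
      moreover have "4 * x + 2 \<le> 6 * max y 1" if "x \<le> y" for x y :: real
        using that by (simp add: max_def)
      ultimately show "4 * ?k + 2 \<le> 6 * max (real (Kfun q p \<beta>)) 1" by blast
    qed
    moreover have "lam0 * real (l0norm q p \<beta>) \<le> lam0 * max (real (l0norm q p \<beta>)) 1"
      using lam0 by (intro mult_left_mono) auto
    moreover have "0 \<le> lam0 * real (l0norm q p \<beta>h)" "0 \<le> lam0 * max (real (l0norm q p \<beta>)) 1"
      using lam0 by auto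
    moreover have "0 \<le> risk n q cat f \<alpha> \<beta>" by (simp add: risk_def sum_nonneg)
    ultimately show ?thesis unfolding distrib_left by linarith
  qed
  then show ?thesis using E by blast
qed

text \<open>The selectable units are single columns, hence \<open>M = 1\<close> and the logarithm of
  the total number of levels. Here \<open>lam0\<close> pays for the noise.\<close>

lemma oracle_event_sparsity:
  assumes n: "n \<ge> 1" and q: "q \<ge> 1" and p: "\<forall>j<q. p j \<ge> 1"
    and cat: "\<forall>i<n. \<forall>j<q. cat i j < p j" and \<sigma>: "\<sigma> > 0" and lam: "lam \<ge> 0"
  defines "L \<equiv> ln (exp 1 * real (\<Sum>j<q. p j))"
  assumes lam0: "lam0 \<ge> 128 * \<sigma>\<^sup>2 * L / real n"
  shows "\<exists>E\<in>sets (noise_space n \<sigma>). measure (noise_space n \<sigma>) E \<ge> 1 - exp (-9 * L) \<and>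
    (\<forall>\<epsilon>\<in>E. \<forall>\<alpha>h \<beta>h \<alpha> \<beta>.
       objective n q p cat (\<lambda>i. f i + \<epsilon> i) lam0 lam \<alpha>h \<beta>h
         \<le> objective n q p cat (\<lambda>i. f i + \<epsilon> i) lam0 lam \<alpha> \<beta> \<longrightarrow>
       risk n q cat f \<alpha>h \<beta>h \<le> 6 * oracle_bound n q p cat f lam0 lam \<alpha> \<beta>)"
proof -
  define J where "J = Sigma {..<q} (\<lambda>j. {..<p j})"
  define I where "I = (\<lambda>S :: (nat \<times> nat) set. insert None (Some ` S))"
  have J: "finite J" "card J = (\<Sum>j<q. p j)" by (auto simp: J_def)
  have "(0, 0) \<in> J" using p q by (auto simp: J_def Suc_le_eq)
  then have J0: "J \<noteq> {}" by blast
  have I: "\<forall>S\<in>Pow J. finite (I S) \<and> card (I S) \<le> 1 + card S * 1"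
    using finite_subset[OF _ J(1)] by (simp add: I_def card_image)
  have "card J \<ge> 1" using J(1) J0 by (simp add: Suc_le_eq card_gt_0_iff)
  then have Lpos: "L \<ge> 0" by (simp add: L_def ln_mult flip: J(2))
  have lam0pos: "lam0 \<ge> 0"
  proof -
    have "0 \<le> 128 * \<sigma>\<^sup>2 * L / real n" using Lpos by simp
    then show ?thesis using lam0 by (rule order_trans)
  qed
  have "real 1 * ln (exp 1 * real (card J)) \<le> L" by (simp add: L_def J(2))
  from noise_event[of \<sigma> J 1 L I n "column cat", OF \<sigma> J(1) J0 order_refl this I]
  obtain E where E: "E \<in> sets (noise_space n \<sigma>)" "measure (noise_space n \<sigma>) E \<ge> 1 - exp (-9 * L)"
    and noise: "\<forall>\<epsilon>\<in>E. \<forall>S c v. S \<subseteq> J \<longrightarrow> (\<forall>i<n. v i = (\<Sum>a\<in>I S. c a * column cat a i)) \<longrightarrow>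
       2 * dotp n \<epsilon> v \<le> dotp n v v / 4 + 128 * \<sigma>\<^sup>2 * L * (real (card S) + 1)"
    by (elim bexE conjE) (rule that)
  have "risk n q cat f \<alpha>h \<beta>h \<le> 6 * oracle_bound n q p cat f lam0 lam \<alpha> \<beta>"
    if \<epsilon>: "\<epsilon> \<in> E" and min: "objective n q p cat (\<lambda>i. f i + \<epsilon> i) lam0 lam \<alpha>h \<beta>h
         \<le> objective n q p cat (\<lambda>i. f i + \<epsilon> i) lam0 lam \<alpha> \<beta>" for \<epsilon> \<alpha>h \<beta>h \<alpha> \<beta>
  proof -
    let ?S = "{(j, k). j < q \<and> k < p j \<and> \<beta>h j k \<noteq> 0} \<union> {(j, k). j < q \<and> k < p j \<and> \<beta> j k \<noteq> 0}"
    let ?v = "\<lambda>i. fitted q cat \<alpha>h \<beta>h i - fitted q cat \<alpha> \<beta> i"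
    let ?kh = "real (l0norm q p \<beta>h)" and ?k = "real (l0norm q p \<beta>)"
    obtain c where c: "\<forall>i<n. ?v i = (\<Sum>a\<in>I ?S. c a * column cat a i)"
      unfolding I_def using fitted_diff_support[OF cat] by blast
    have S: "?S \<subseteq> J" by (auto simp: J_def)
    have "card ?S \<le> l0norm q p \<beta>h + l0norm q p \<beta>" unfolding l0norm_def by (rule card_Un_le)
    then have cardS: "real (card ?S) \<le> ?kh + ?k" by linarith
    have "2 * dotp n \<epsilon> ?v \<le> dotp n ?v ?v / 4 + 128 * \<sigma>\<^sup>2 * L * (real (card ?S) + 1)"
      by (rule noise[THEN bspec, OF \<epsilon>, THEN spec, THEN spec, THEN spec, THEN mp, THEN mp, OF S c])
    also have "128 * \<sigma>\<^sup>2 * L * (real (card ?S) + 1) \<le> (real n * lam0) * (?kh + ?k + 1)"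
    proof (rule mult_mono)
      show "128 * \<sigma>\<^sup>2 * L \<le> real n * lam0" using lam0 n by (simp add: field_simps)
    qed (use lam0pos cardS in auto)
    finally have "2 * dotp n \<epsilon> ?v \<le> dotp n ?v ?v / 4 + real n * (lam0 * (?kh + ?k + 1))"
      by (simp add: mult.assoc)
    \<comment> \<open>The support size of the minimiser cancels between the noise bound and its own
      penalty.\<close>
    from basic_inequality[OF n min this]
    have "risk n q cat f \<alpha>h \<beta>h \<le> 3 * risk n q cat f \<alpha> \<beta> + lam0 * (4 * ?k + 2)
        + 2 * (lam * (real (ndistinct q p \<beta>) - real (ndistinct q p \<beta>h)))"
      by (simp add: algebra_simps)
    moreover have "lam0 * (4 * ?k + 2) \<le> lam0 * (6 * max ?k 1)"
      using lam0pos by (intro mult_left_mono) linarith+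
    \<comment> \<open>The unavoidable \<open>q\<close> values, one per predictor, occur on both
      sides and cancel, which leaves only the nonzero values of the competitor.\<close>
    moreover have "lam * (real (ndistinct q p \<beta>) - real (ndistinct q p \<beta>h)) \<le> lam * max (real (Kfun q p \<beta>)) 1"
      using ndistinct_le[of q p \<beta>] ndistinct_ge[OF p, of \<beta>h] lam by (intro mult_left_mono) linarith+
    moreover have "0 \<le> lam * max (real (Kfun q p \<beta>)) 1" using lam by auto
    moreover have "0 \<le> risk n q cat f \<alpha> \<beta>" by (simp add: risk_def sum_nonneg)
    ultimately show ?thesis unfolding distrib_left by linarith
  qed
  then show ?thesis using E by blast
qed

theorem theorem2:
  shows "\<exists>c_lam clam0 C :: real. c_lam > 0 \<and> clam0 > 0 \<and> C > 0 \<and>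
    (\<forall>(n::nat) (q::nat) (p::nat \<Rightarrow> nat) (cat::nat \<Rightarrow> nat \<Rightarrow> nat) (f::nat \<Rightarrow> real) (\<sigma>::real) (lam::real) (lam0::real).
      n \<ge> 1 \<longrightarrow> q \<ge> 1 \<longrightarrow> (\<forall>j<q. p j \<ge> 1) \<longrightarrow> (\<forall>i<n. \<forall>j<q. cat i j < p j) \<longrightarrow>
      \<sigma> > 0 \<longrightarrow> lam \<ge> 0 \<longrightarrow> lam0 \<ge> 0 \<longrightarrow>
      (let P = (\<Sum>j<q. p j); pmax = Max (p ` {..<q}) in
        (lam \<ge> c_lam * \<sigma>\<^sup>2 * real pmax * ln (exp 1 * real q) / real n
         \<or> lam0 \<ge> clam0 * \<sigma>\<^sup>2 * ln (exp 1 * real P) / real n) \<longrightarrow>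
        (\<exists>E \<in> sets (noise_space n \<sigma>).
           measure (noise_space n \<sigma>) E \<ge>
             1 - 8 * (exp 1 * real P) powr (-9) - 8 * (exp 1 * real q) powr (- 9 * real pmax) \<and>
           (\<forall>\<epsilon>\<in>E. \<forall>\<alpha>h \<beta>h.
              (\<forall>\<alpha> \<beta>. objective n q p cat (\<lambda>i. f i + \<epsilon> i) lam0 lam \<alpha>h \<beta>h
                       \<le> objective n q p cat (\<lambda>i. f i + \<epsilon> i) lam0 lam \<alpha> \<beta>) \<longrightarrow>
              risk n q cat f \<alpha>h \<beta>h \<le>
                C * (INF ab \<in> (UNIV :: (real \<times> (nat \<Rightarrow> nat \<Rightarrow> real)) set).
                       risk n q cat f (fst ab) (snd ab)
                       + lam0 * max (real (l0norm q p (snd ab))) 1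
                       + lam * max (real (Kfun q p (snd ab))) 1)))))"
proof -
  have main: "\<exists>E \<in> sets (noise_space n \<sigma>).
           measure (noise_space n \<sigma>) E \<ge>
             1 - 8 * (exp 1 * real P) powr (-9) - 8 * (exp 1 * real q) powr (- 9 * real pmax) \<and>
           (\<forall>\<epsilon>\<in>E. \<forall>\<alpha>h \<beta>h.
              (\<forall>\<alpha> \<beta>. objective n q p cat (\<lambda>i. f i + \<epsilon> i) lam0 lam \<alpha>h \<beta>h
                       \<le> objective n q p cat (\<lambda>i. f i + \<epsilon> i) lam0 lam \<alpha> \<beta>) \<longrightarrow>
              risk n q cat f \<alpha>h \<beta>h \<le> 6 * (INF ab. oracle_bound n q p cat f lam0 lam (fst ab) (snd ab)))"
    if n: "n \<ge> 1" and q: "q \<ge> 1" and p: "\<forall>j<q. p j \<ge> 1" and cat: "\<forall>i<n. \<forall>j<q. cat i j < p j"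
      and \<sigma>: "\<sigma> > 0" and lam: "lam \<ge> 0" and lam0: "lam0 \<ge> 0"
      and P: "P = (\<Sum>j<q. p j)" and pmax: "pmax = Max (p ` {..<q})"
      and large: "lam \<ge> 128 * \<sigma>\<^sup>2 * real pmax * ln (exp 1 * real q) / real n
         \<or> lam0 \<ge> 128 * \<sigma>\<^sup>2 * ln (exp 1 * real P) / real n"
    for n q :: nat and p cat f \<sigma> lam lam0 P pmax
  proof -
    have "P > 0"
      using member_le_sum[of 0 "{..<q}" p] p q unfolding P by fastforce
    \<comment> \<open>Rewrites the failure probabilities of the two events as the powers in the
      claim; positivity of the bases is needed for this.\<close>
    then have powrs: "exp (-9 * ln (exp 1 * real P)) = (exp 1 * real P) powr (-9)"
      "exp (-9 * (real pmax * ln (exp 1 * real q))) = (exp 1 * real q) powr (- 9 * real pmax)"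
      using q by (auto simp: powr_def)
    have pos: "(exp 1 * real P) powr (-9) \<ge> 0" "(exp 1 * real q) powr (- 9 * real pmax) \<ge> 0"
      by (rule powr_ge_zero)+
    \<comment> \<open>Each regime fails with probability at most one of the two powers, so
      subtracting eight times both is a weaker demand.\<close>
    have "\<exists>E\<in>sets (noise_space n \<sigma>). measure (noise_space n \<sigma>) E \<ge>
         1 - 8 * (exp 1 * real P) powr (-9) - 8 * (exp 1 * real q) powr (- 9 * real pmax) \<and>
       (\<forall>\<epsilon>\<in>E. \<forall>\<alpha>h \<beta>h \<alpha> \<beta>. objective n q p cat (\<lambda>i. f i + \<epsilon> i) lam0 lam \<alpha>h \<beta>h
          \<le> objective n q p cat (\<lambda>i. f i + \<epsilon> i) lam0 lam \<alpha> \<beta> \<longrightarrow>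
          risk n q cat f \<alpha>h \<beta>h \<le> 6 * oracle_bound n q p cat f lam0 lam \<alpha> \<beta>)"
      (is "\<exists>E\<in>_. measure _ E \<ge> ?prob \<and> _")
      using large
    proof
      assume "lam \<ge> 128 * \<sigma>\<^sup>2 * real pmax * ln (exp 1 * real q) / real n"
      then have "lam \<ge> 128 * \<sigma>\<^sup>2 * (real pmax * ln (exp 1 * real q)) / real n"
        by (simp add: mult.assoc)
      from oracle_event_clustering[OF n q p cat \<sigma> lam0, folded pmax, OF this, of f]
      show ?thesis
      proof (elim bexE conjE)
        fix E assume "1 - exp (-9 * (real pmax * ln (exp 1 * real q))) \<le> measure (noise_space n \<sigma>) E"
        then have "?prob \<le> measure (noise_space n \<sigma>) E" unfolding powrs using pos by linarith
        then show ?thesis if "E \<in> sets (noise_space n \<sigma>)" "\<forall>\<epsilon>\<in>E. \<forall>\<alpha>h \<beta>h \<alpha> \<beta>.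
          objective n q p cat (\<lambda>i. f i + \<epsilon> i) lam0 lam \<alpha>h \<beta>h
          \<le> objective n q p cat (\<lambda>i. f i + \<epsilon> i) lam0 lam \<alpha> \<beta> \<longrightarrow>
          risk n q cat f \<alpha>h \<beta>h \<le> 6 * oracle_bound n q p cat f lam0 lam \<alpha> \<beta>"
          using that by blast
      qed
    next
      assume "lam0 \<ge> 128 * \<sigma>\<^sup>2 * ln (exp 1 * real P) / real n"
      from oracle_event_sparsity[OF n q p cat \<sigma> lam, folded P, OF this, of f]
      show ?thesis
      proof (elim bexE conjE)
        fix E assume "1 - exp (-9 * ln (exp 1 * real P)) \<le> measure (noise_space n \<sigma>) E"
        then have "?prob \<le> measure (noise_space n \<sigma>) E" unfolding powrs using pos by linarith
        then show ?thesis if "E \<in> sets (noise_space n \<sigma>)" "\<forall>\<epsilon>\<in>E. \<forall>\<alpha>h \<beta>h \<alpha> \<beta>.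
          objective n q p cat (\<lambda>i. f i + \<epsilon> i) lam0 lam \<alpha>h \<beta>h
          \<le> objective n q p cat (\<lambda>i. f i + \<epsilon> i) lam0 lam \<alpha> \<beta> \<longrightarrow>
          risk n q cat f \<alpha>h \<beta>h \<le> 6 * oracle_bound n q p cat f lam0 lam \<alpha> \<beta>"
          using that by blast
      qed
    qed
    moreover have "r \<le> 6 * (INF ab. oracle_bound n q p cat f lam0 lam (fst ab) (snd ab))"
      if "\<And>\<alpha> \<beta>. r \<le> 6 * oracle_bound n q p cat f lam0 lam \<alpha> \<beta>" for r
    proof -
      have div6: "x / 6 \<le> y" if "x \<le> 6 * y" for x y :: real
        using that by simp
      \<comment> \<open>The event does not depend on the competitor, so the bound holds for all
        competitors at once and \<open>r / 6\<close> is a lower bound of the whole family.\<close>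
      have "r / 6 \<le> (INF ab. oracle_bound n q p cat f lam0 lam (fst ab) (snd ab))"
      proof (rule cINF_greatest)
        fix ab
        show "r / 6 \<le> oracle_bound n q p cat f lam0 lam (fst ab) (snd ab)"
          by (intro div6 that)
      qed simp
      then show ?thesis by simp
    qed
    ultimately show ?thesis by meson
  qed
  show ?thesis
    unfolding Let_def
    by (rule exI[of _ 128], rule exI[of _ 128], rule exI[of _ 6])
       (intro conjI allI impI main refl; simp)
qed

end
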